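(* Let $P' \subseteq \mathbb{R}^p$ be a $0/1$-polytope and let $a \in \mathbb{R}^p$, $\beta \in \mathbb{R}$ induce a symmetry of the cube such that $P' \subseteq H^{\leq}(a,\beta)$. Then, with $H = H^{=}(a,\beta)$, \[ \operatorname{xc}^*\big(\operatorname{conv}(P' \cup \varphi_H(P'))\big) \leq \operatorname{xc}^*(P') + 2. \]
   Context: A $0/1$-polytope is a polytope all of whose vertices lie in $\{0,1\}^p$. For a polytope $P \subseteq \mathbb{R}^p$, an extension of $P$ is a pair $(Q,\pi)$ with $Q \subseteq \mathbb{R}^q$ a polyhedron and $\pi\colon\mathbb{R}^q\to\mathbb{R}^p$ linear with $\pi(Q)=P$; its size is the number of facets of $Q$. An extension $(Q,\pi)$ of a $0/1$-polytope $P$ is a nice $0/1$-extension if (i) $Q$ is a $0/1$-polytope, (ii) each vertex of $Q$ is mapped by $\pi$ onto a vertex of $P$, and (iii) for each vertex $v$ of $P$ there is exactly one vertex of $Q$ mapped onto $v$. $\operatorname{xc}^*(P)$ is the smallest size of a nice $0/1$-extension of $P$. For $a \neq 0$, $H^{\leq}(a,\beta) = \{x : \langle a,x\rangle \leq \beta\}$, $H^{=}(a,\beta) = \{x : \langle a,x\rangle = \beta\}$, and for $H = H^{=}(a,\beta)$ the reflection at $H$ is $\varphi_H(x) = x + 2\frac{\beta - \langle a,x\rangle}{\|a\|^2} a$. The pair $(a,\beta)$ induces a symmetry of the cube if either (flip) for some $i \in [p]$, $a = 2e_i,\ \beta = 1$ or $a = -2e_i,\ \beta=-1$ (so $\varphi_H$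 replaces $x_i$ by $1-x_i$), or (swap) for some $i \neq j$, $\beta = 0$ and $a = e_i - e_j$ or $a = e_j - e_i$ (so $\varphi_H$ exchanges coordinates $i$ and $j$); here $e_i$ is the $i$th unit vector. *)

theory Defs
  imports "HOL-Analysis.Analysis" "HOL-Analysis.Finite_Function_Topology" "HOL-Library.Extended_Nat"
begin

section \<open>Extensions in spaces of arbitrary dimension\<close>

text \<open>
  The dimension of the space containing an extension is quantified existentially in the definition
  of \<open>xc_star\<close>, so it cannot be a type parameter. The space \<open>\<real>\<^sup>q\<close> is therefore the subspace of the
  real vector space \<^typ>\<open>nat \<Rightarrow>\<^sub>0 real\<close> of all vectors supported on the coordinates \<open>0, \<dots>, q - 1\<close>.
\<close>

definition coord_space :: "nat \<Rightarrow> (nat \<Rightarrow>\<^sub>0 real) set" where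
  "coord_space q = {x. Poly_Mapping.keys x \<subseteq> {..<q}}"

definition polyhedron_in :: "nat \<Rightarrow> (nat \<Rightarrow>\<^sub>0 real) set \<Rightarrow> bool" where
  "polyhedron_in q Q \<longleftrightarrow>
     (\<exists>A :: ((nat \<Rightarrow> real) \<times> real) set. finite A \<and>
        Q = {x \<in> coord_space q. \<forall>(c, b) \<in> A. (\<Sum>i<q. c i * Poly_Mapping.lookup x i) \<le> b})"

text \<open>
  The library's \<^const>\<open>aff_dim\<close> and \<^const>\<open>facet_of\<close> are restricted to the class
  \<^class>\<open>euclidean_space\<close>, of which \<^typ>\<open>nat \<Rightarrow>\<^sub>0 real\<close> is not an instance. The two definitions
  below extend them to all real vector spaces (for sets of finite dimension); the two lemmas
  confirm that they agree on Euclidean spaces.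
\<close>

definition affine_dim :: "'a::real_vector set \<Rightarrow> int" where
  "affine_dim S = (if S = {} then - 1 else int (dim {x - y | x y. x \<in> S \<and> y \<in> S}))"

definition is_facet :: "'a::real_vector set \<Rightarrow> 'a set \<Rightarrow> bool" where
  "is_facet F Q \<longleftrightarrow> F face_of Q \<and> F \<noteq> {} \<and> affine_dim F = affine_dim Q - 1"

lemma affine_dim_eq_aff_dim:
  fixes S :: "'a::euclidean_space set"
  shows "affine_dim S = aff_dim S"
proof (cases "S = {}")
  case False
  then obtain a where a: "a \<in> S" by blast
  let ?D = "{x - y | x y. x \<in> S \<and> y \<in> S}"
  let ?T = "(+) (- a) ` S"
  have "?T \<subseteq> ?D" using a by force
  moreover have "?D \<subseteq> span ?T"
  proof
    fix d assume "d \<in> ?D"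
    then obtain x y where xy: "x \<in> S" "y \<in> S" "d = x - y" by blast
    then have "(- a + x) - (- a + y) \<in> span ?T"
      by (intro span_diff span_base) auto
    then show "d \<in> span ?T" using xy by simp
  qed
  ultimately have "span ?D = span ?T"
    by (simp add: span_eq subset_trans[OF _ span_superset])
  then have "dim ?D = dim ?T" by (rule span_eq_dim)
  then show ?thesis
    using aff_dim_eq_dim[of a S] a False by (simp add: affine_dim_def hull_inc)
qed (simp add: affine_dim_def)

lemma is_facet_eq_facet_of:
  fixes F Q :: "'a::euclidean_space set"
  shows "is_facet F Q \<longleftrightarrow> F facet_of Q"
  by (simp add: is_facet_def facet_of_def affine_dim_eq_aff_dim)

definition num_facets :: "'a::real_vector set \<Rightarrow> nat" where
  "num_facets Q = card {F. is_facet F Q}"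

text \<open>Since every linear map on \<open>\<real>\<^sup>q\<close> extends to the whole of \<^typ>\<open>nat \<Rightarrow>\<^sub>0 real\<close>, it is no
  restriction that the projection is a linear map on that type.\<close>

definition is_extension ::
    "nat \<Rightarrow> (nat \<Rightarrow>\<^sub>0 real) set \<Rightarrow> ((nat \<Rightarrow>\<^sub>0 real) \<Rightarrow> real^'p) \<Rightarrow> (real^'p) set \<Rightarrow> bool" where
  "is_extension q Q \<pi> P \<longleftrightarrow> polyhedron_in q Q \<and> linear \<pi> \<and> \<pi> ` Q = P"


section \<open>Nice 0/1-extensions\<close>

definition zero_one_polytope :: "(real^'p) set \<Rightarrow> bool" where
  "zero_one_polytope P \<longleftrightarrow>
     polytope P \<and> (\<forall>v. v extreme_point_of P \<longrightarrow> (\<forall>i. v $ i \<in> {0, 1}))"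

definition zero_one_polytope_in :: "nat \<Rightarrow> (nat \<Rightarrow>\<^sub>0 real) set \<Rightarrow> bool" where
  "zero_one_polytope_in q Q \<longleftrightarrow>
     Q \<subseteq> coord_space q \<and> polytope Q \<and>
     (\<forall>v. v extreme_point_of Q \<longrightarrow> (\<forall>i<q. Poly_Mapping.lookup v i \<in> {0, 1}))"

definition nice_zero_one_extension ::
    "nat \<Rightarrow> (nat \<Rightarrow>\<^sub>0 real) set \<Rightarrow> ((nat \<Rightarrow>\<^sub>0 real) \<Rightarrow> real^'p) \<Rightarrow> (real^'p) set \<Rightarrow> bool" where
  "nice_zero_one_extension q Q \<pi> P \<longleftrightarrow>
     zero_one_polytope P \<and> is_extension q Q \<pi> P \<and>
     zero_one_polytope_in q Q \<and>
     (\<forall>w. w extreme_point_of Q \<longrightarrow> \<pi> w extreme_point_of P) \<and>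
     (\<forall>v. v extreme_point_of P \<longrightarrow> (\<exists>!w. w extreme_point_of Q \<and> \<pi> w = v))"

text \<open>The infimum is taken in \<^typ>\<open>enat\<close>, so that it would be \<open>\<infinity>\<close> (and not an arbitrary number) if
  there were no nice 0/1-extension; otherwise it is the minimum.\<close>

definition xc_star :: "(real^'p) set \<Rightarrow> enat" where
  "xc_star P = Inf {enat (num_facets Q) | q Q \<pi>. nice_zero_one_extension q Q \<pi> P}"


section \<open>Reflections and symmetries of the cube\<close>

definition reflection :: "'a::real_inner \<Rightarrow> real \<Rightarrow> 'a \<Rightarrow> 'a" where
  "reflection a \<beta> x = x + (2 * ((\<beta> - a \<bullet> x) / (norm a)\<^sup>2)) *\<^sub>R a"

definition induces_cube_symmetry :: "real^'p \<Rightarrow> real \<Rightarrow> bool" where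
  "induces_cube_symmetry a \<beta> \<longleftrightarrow>
     (\<exists>i. (a = 2 *\<^sub>R axis i 1 \<and> \<beta> = 1) \<or> (a = - (2 *\<^sub>R axis i 1) \<and> \<beta> = - 1)) \<or>
     (\<exists>i j. i \<noteq> j \<and> \<beta> = 0 \<and> (a = axis i 1 - axis j 1 \<or> a = axis j 1 - axis i 1))"

end

theory Submission
  imports Defs
begin

text \<open>
  Let \<open>(S, \<pi>')\<close> be a minimal nice 0/1-extension of \<open>P'\<close>. The function \<open>h z = \<beta> - a \<bullet> \<pi>' z\<close> is affine,
  nonnegative on \<open>S\<close> and, by the two shapes of a cube symmetry, 0/1-valued at the vertices of \<open>S\<close>. The
  prism \<open>Q = {(z, t) | z \<in> S, 0 \<le> t \<le> h z}\<close> has the vertices \<open>(z, 0)\<close> and \<open>(z, h z)\<close> for \<open>z\<close> a vertex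
  of \<open>S\<close>, so it is a 0/1-polytope. The map \<open>(z, t) \<mapsto> \<pi>' z + (2 t / \<parallel>a\<parallel>\<^sup>2) a\<close> sends these to \<open>\<pi>' z\<close> and its
  mirror image. Every facet of \<open>Q\<close> is the bottom, the roof, or lies over a facet of \<open>S\<close>.
\<close>

subsection \<open>Faces of polytopes in real vector spaces\<close>

text \<open>The points of \<open>convex hull S\<close> that are either outside \<open>F\<close> or
  in \<open>convex hull (F \<inter> S)\<close> form a convex set: if a point inside a segment lies
  in \<open>F\<close>, the face property puts both endpoints in \<open>F\<close>. This convex set
  contains \<open>S\<close>, hence the whole hull.\<close>

lemma face_of_convex_hull_eq:
  fixes S :: "'a::real_vector set"
  assumes F: "F face_of convex hull S"
  shows "F = convex hull (F \<inter> S)"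
proof
  let ?C = "{x \<in> convex hull S. x \<in> F \<longrightarrow> x \<in> convex hull (F \<inter> S)}"
  have "convex ?C"
  proof -
    have "w \<in> ?C" if x: "x \<in> ?C" and y: "y \<in> ?C" and w: "w \<in> open_segment x y" for x y w
    proof -
    have wS: "w \<in> convex hull S"
      using x y w convex_convex_hull[of S] unfolding convex_contains_open_segment by blast
    have "w \<in> convex hull (F \<inter> S)" if "w \<in> F"
    proof -
      have "x \<in> F \<and> y \<in> F" using face_ofD[OF F w] x y that by blast
      then show ?thesis
        using x y w convex_convex_hull[of "F \<inter> S"] unfolding convex_contains_open_segment by blast
    qed
    then show ?thesis using wS by blast
    qed
    then show ?thesis unfolding convex_contains_open_segment by blast
  qed
  moreover have "S \<subseteq> ?C" by (auto intro: hull_inc)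
  ultimately have "convex hull S \<subseteq> ?C" by (rule hull_minimal[rotated])
  then show "F \<subseteq> convex hull (F \<inter> S)" using face_of_imp_subset[OF F] by blast
  show "convex hull (F \<inter> S) \<subseteq> F"
    using face_of_imp_convex[OF F] by (intro hull_minimal) auto
qed

text \<open>A face is determined by the points of \<open>V\<close> in it. Finiteness matters because
  \<open>num_facets\<close> is a \<open>card\<close>, which would be 0 on an infinite
  family.\<close>

lemma finite_faces_of_polytope:
  fixes S :: "'a::real_vector set"
  assumes "polytope S"
  shows "finite {F. F face_of S}"
proof -
  obtain V where V: "finite V" "S = convex hull V"
    using assms unfolding polytope_def by blast
  have "{F. F face_of S} \<subseteq> (\<lambda>W. convex hull W) ` Pow V"
    using face_of_convex_hull_eq[of _ V] V by blast
  then show ?thesis using V finite_subset by blast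
qed

section \<open>Dimensions of proper faces\<close>

definition differences :: "'a::real_vector set \<Rightarrow> 'a set" where
  "differences S = {x - y | x y. x \<in> S \<and> y \<in> S}"

lemma affine_dim_differences:
  "affine_dim S = (if S = {} then - 1 else int (dim (differences S)))"
  by (simp add: affine_dim_def differences_def)

text \<open>For a convex set, the nonnegative multiples of differences already form a subspace, the
  direction space of the affine hull. Negation swaps \<open>u\<close> and \<open>v\<close>; a sum
  with factors \<open>t\<close> and \<open>s\<close> is \<open>t + s\<close> times the difference of
  two averages with weights \<open>t / (t + s)\<close> and \<open>s / (t + s)\<close>.\<close>

lemma span_differences_convex:
  fixes S :: "'a::real_vector set"
  assumes S: "convex S" "S \<noteq> {}" and d: "d \<in> span (differences S)"
  obtains t u v where "t \<ge> 0" "u \<in> S" "v \<in> S" "d = t *\<^sub>R (u - v)"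
proof -
  let ?C = "{t *\<^sub>R (u - v) | t u v. t \<ge> 0 \<and> u \<in> S \<and> v \<in> S}"
  have "subspace ?C"
  proof (rule subspaceI)
    show "0 \<in> ?C" using S(2) by (auto intro!: exI[of _ "0::real"])
  next
    fix x y assume "x \<in> ?C" "y \<in> ?C"
    then obtain t u v s w z where x: "t \<ge> 0" "u \<in> S" "v \<in> S" "x = t *\<^sub>R (u - v)"
      and y: "s \<ge> 0" "w \<in> S" "z \<in> S" "y = s *\<^sub>R (w - z)" by blast
    show "x + y \<in> ?C"
    proof (cases "t + s = 0")
      case True
      then have "t = 0" "s = 0" using x y by auto
      then show ?thesis using x y by (auto intro!: exI[of _ "0::real"])
    next
      case False
      then have pos: "t + s > 0" using x y by auto
      let ?a = "(t / (t + s)) *\<^sub>R u + (s / (t + s)) *\<^sub>R w"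
      let ?b = "(t / (t + s)) *\<^sub>R v + (s / (t + s)) *\<^sub>R z"
      have sum: "t / (t + s) + s / (t + s) = 1"
        using pos by (simp add: add_divide_distrib[symmetric])
      have "?a \<in> S" "?b \<in> S"
        using x y pos sum by (auto intro!: convexD[OF S(1)])
      moreover have "x + y = (t + s) *\<^sub>R (?a - ?b)"
      proof -
        have "(t + s) *\<^sub>R ?a = t *\<^sub>R u + s *\<^sub>R w" "(t + s) *\<^sub>R ?b = t *\<^sub>R v + s *\<^sub>R z"
          using pos by (simp_all add: scaleR_right_distrib del: scaleR_collapse)
        then show ?thesis
          using x y by (simp only: scaleR_right_diff_distrib) (simp add: algebra_simps)
      qed
      ultimately show ?thesis using pos by (intro CollectI exI[of _ "t + s"] exI[of _ ?a] exI[of _ ?b]) auto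
    qed
  next
    fix c x assume "x \<in> ?C"
    then obtain t u v where x: "t \<ge> 0" "u \<in> S" "v \<in> S" "x = t *\<^sub>R (u - v)" by blast
    show "c *\<^sub>R x \<in> ?C"
    proof (cases "c \<ge> 0")
      case True
      then show ?thesis using x by (intro CollectI exI[of _ "c * t"] exI[of _ u] exI[of _ v]) auto
    next
      case False
      then have "- c * t \<ge> 0" using x by (intro mult_nonneg_nonneg) auto
      moreover have "c *\<^sub>R x = (- c * t) *\<^sub>R (v - u)"
        unfolding x(4) by (simp add: algebra_simps)
      ultimately show ?thesis using x by blast
    qed
  qed
  moreover have "differences S \<subseteq> ?C"
    unfolding differences_def by (force intro!: exI[of _ "1::real"])
  ultimately have "span (differences S) \<subseteq> ?C" by (rule span_minimal[rotated])
  then show thesis using d that by blast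
qed

text \<open>Suppose \<open>x\<close> in \<open>S\<close> is outside \<open>F\<close>, and let
  \<open>f\<close> be in \<open>F\<close>. Writing \<open>x - f = t *\<^sub>R (u - v)\<close> with
  \<open>u\<close>, \<open>v\<close> in \<open>F\<close> gives
  \<open>f + t *\<^sub>R u = x + t *\<^sub>R v\<close>. Divided by \<open>1 + t\<close>, the left
  side is a point of \<open>F\<close> and the right side lies strictly between \<open>x\<close> and
  \<open>v\<close>, so the face property forces \<open>x\<close> into \<open>F\<close>.\<close>

lemma face_of_eq_if_span_differences:
  fixes S :: "'a::real_vector set"
  assumes F: "F face_of S" and S: "convex S" and ne: "F \<noteq> {}"
    and span: "differences S \<subseteq> span (differences F)"
  shows "F = S"
proof
  show "F \<subseteq> S" using F by (rule face_of_imp_subset)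
  show "S \<subseteq> F"
  proof (rule ccontr)
    assume "\<not> S \<subseteq> F"
    then obtain x where x: "x \<in> S" "x \<notin> F" by blast
    obtain f where f: "f \<in> F" using ne by blast
    have "x - f \<in> span (differences F)"
      using span x f \<open>F \<subseteq> S\<close> unfolding differences_def by blast
    then obtain t u v where t: "t \<ge> 0" "u \<in> F" "v \<in> F" "x - f = t *\<^sub>R (u - v)"
      by (rule span_differences_convex[OF face_of_imp_convex[OF F] ne])
    have "t \<noteq> 0" using t x f by auto
    define w where "w = (1 / (1 + t)) *\<^sub>R f + (t / (1 + t)) *\<^sub>R u"
    have sum: "1 / (1 + t) + t / (1 + t) = 1"
      using t by (simp add: add_divide_distrib[symmetric])
    have wF: "w \<in> F"
      unfolding w_def using t f sum by (intro convexD[OF face_of_imp_convex[OF F]]) auto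
    have "(1 + t) *\<^sub>R w = f + t *\<^sub>R u"
      using t unfolding w_def by (simp add: scaleR_right_distrib)
    also have "\<dots> = x + t *\<^sub>R v" using t by (simp add: algebra_simps)
    finally have "w = (1 / (1 + t)) *\<^sub>R (x + t *\<^sub>R v)"
      using t by (metis add_nonneg_pos divide_inverse mult_1 scaleR_one scaleR_scaleR
          left_inverse less_irrefl zero_less_one add.commute)
    then have w: "w = (1 - t / (1 + t)) *\<^sub>R x + (t / (1 + t)) *\<^sub>R v"
      using sum by (simp add: scaleR_right_distrib eq_diff_eq[symmetric])
    have "w \<in> open_segment x v"
      unfolding in_segment using w t \<open>t \<noteq> 0\<close> x by (auto intro!: exI[of _ "t / (1 + t)"])
    then show False using face_ofD[OF F _ x(1) _ wF] t \<open>F \<subseteq> S\<close> x by blast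
  qed
qed

text \<open>A basis of \<open>V\<close> extends to one of \<open>W\<close>, and equal cardinalities
  make them coincide. The ambient space may be infinite-dimensional, so \<open>T\<close> supplies
  the finiteness that this comparison needs.\<close>

lemma span_eq_if_dim_le:
  fixes V W :: "'a::real_vector set"
  assumes VW: "V \<subseteq> W" and T: "finite T" "W \<subseteq> span T" and dim: "dim W \<le> dim V"
  shows "W \<subseteq> span V"
proof -
  obtain B where B: "B \<subseteq> V" "independent B" "V \<subseteq> span B" "card B = dim V"
    by (rule real_vector.basis_exists)
  obtain C where C: "B \<subseteq> C" "C \<subseteq> W" "independent C" "W \<subseteq> span C"
    using real_vector.maximal_independent_subset_extend[OF subset_trans[OF B(1) VW] B(2)] by blast
  have fin: "finite C" using real_vector.independent_span_bound[OF T(1) C(3)] C T by auto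
  have "card C = dim W" using real_vector.basis_card_eq_dim[OF C(2,4,3)] by simp
  then have "B = C" using card_subset_eq[OF fin C(1)] card_mono[OF fin C(1)] B dim by auto
  then show ?thesis using C B span_mono by blast
qed

text \<open>If the dimension did not drop, the face would span all directions of \<open>S\<close>
  and hence be \<open>S\<close>. The empty face is covered by its dimension being -1.\<close>

lemma affine_dim_face_less:
  fixes S :: "'a::real_vector set"
  assumes F: "F face_of S" and S: "convex S" and ne: "F \<noteq> S"
    and T: "finite T" "S \<subseteq> span T"
  shows "affine_dim F < affine_dim S"
proof (cases "F = {}")
  case True
  then show ?thesis using ne by (simp add: affine_dim_differences)
next
  case False
  have sub: "F \<subseteq> S" using F by (rule face_of_imp_subset)
  have "differences F \<subseteq> differences S" using sub unfolding differences_def by blast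
  moreover have "differences S \<subseteq> span T"
    using T unfolding differences_def by (auto intro: span_diff)
  moreover have "\<not> differences S \<subseteq> span (differences F)"
    using face_of_eq_if_span_differences[OF F S False] ne by blast
  ultimately have "dim (differences F) < dim (differences S)"
    using span_eq_if_dim_le[OF _ T(1), of "differences F" "differences S"] by force
  then show ?thesis using False sub by (auto simp: affine_dim_differences)
qed

lemma dim_insert_outside_span:
  fixes V :: "'a::real_vector set"
  assumes "e \<notin> span V" "finite T" "V \<subseteq> span T"
  shows "dim (insert e V) = dim V + 1"
proof -
  obtain B where B: "B \<subseteq> V" "independent B" "V \<subseteq> span B" "card B = dim V"
    by (rule real_vector.basis_exists)
  have fin: "finite B" using real_vector.independent_span_bound[OF assms(2) B(2)] B assms by auto
  have e: "e \<notin> span B" using assms B span_mono by blast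
  then have "e \<notin> B" using span_base by blast
  show ?thesis
  proof (rule real_vector.dim_unique)
    show "insert e B \<subseteq> insert e V" using B by auto
    show "insert e V \<subseteq> span (insert e B)"
      using B span_mono[of B "insert e B"] span_base[of e "insert e B"] by auto
    show "independent (insert e B)" using B e by (simp add: real_vector.independent_insert)
    show "card (insert e B) = dim V + 1" using fin \<open>e \<notin> B\<close> B by simp
  qed
qed


text \<open>Two nonnegative terms with positive weights and sum 0 both vanish. Only affinity is
  asked of \<open>f\<close>, so that the lemma serves both the height above the bottom and the slack
  below the roof.\<close>

lemma face_of_zeros_of_nonneg_affine:
  fixes f :: "'a::real_vector \<Rightarrow> real"
  assumes S: "convex S" and nonneg: "\<And>x. x \<in> S \<Longrightarrow> f x \<ge> 0"
    and affine: "\<And>u x y. f ((1 - u) *\<^sub>R x + u *\<^sub>R y) = (1 - u) * f x + u * f y"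
  shows "{x \<in> S. f x = 0} face_of S"
  unfolding face_of_def
proof (intro conjI ballI impI)
  show "convex {x \<in> S. f x = 0}"
    unfolding convex_alt using S affine by (auto simp: convex_alt)
next
  fix a b x assume a: "a \<in> S" and b: "b \<in> S" and x: "x \<in> {x \<in> S. f x = 0}"
    and seg: "x \<in> open_segment a b"
  obtain u where u: "0 < u" "u < 1" "x = (1 - u) *\<^sub>R a + u *\<^sub>R b"
    using seg by (auto simp: in_segment)
  have "(1 - u) * f a + u * f b = 0" using x u affine by simp
  moreover have "(1 - u) * f a \<ge> 0" "u * f b \<ge> 0" using u nonneg a b by auto
  ultimately have "(1 - u) * f a = 0 \<and> u * f b = 0" by linarith
  then show "a \<in> {x \<in> S. f x = 0}" "b \<in> {x \<in> S. f x = 0}" using u a b by auto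
qed auto

subsection \<open>Prisms under an affine function\<close>

text \<open>The prism lives in the same type as \<open>S\<close>, since all coordinate spaces share
  one type. The extra dimension is therefore a vector \<open>e\<close> together with a functional
  \<open>m\<close> that reads the height and vanishes on \<open>S\<close>.\<close>

locale prism_under_affine =
  fixes m g h :: "'a::real_vector \<Rightarrow> real" and c :: real and e :: 'a and S :: "'a set"
  assumes linear_m: "linear m" and m_e: "m e = 1" and m_S: "\<And>z. z \<in> S \<Longrightarrow> m z = 0"
    and linear_g: "linear g" and h_eq: "\<And>z. h z = c - g z"
    and convex_S: "convex S" and h_nonneg: "\<And>z. z \<in> S \<Longrightarrow> h z \<ge> 0"
begin

definition base :: "'a \<Rightarrow> 'a" where
  "base x = x - m x *\<^sub>R e"

definition prism :: "'a set" where
  "prism = {x. base x \<in> S \<and> 0 \<le> m x \<and> m x \<le> h (base x)}"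

lemma m_simps [simp]: "m (x + y) = m x + m y" "m (x - y) = m x - m y" "m (r *\<^sub>R x) = r * m x" "m e = 1"
  using linear_m m_e by (simp_all add: linear_add linear_diff linear_scale)

lemma g_simps [simp]: "g (x + y) = g x + g y" "g (x - y) = g x - g y" "g (r *\<^sub>R x) = r * g x"
  using linear_g by (simp_all add: linear_add linear_diff linear_scale)

lemma linear_base: "linear base"
  unfolding base_def by (rule linearI) (simp_all add: algebra_simps)

lemma base_simps [simp]:
  "base (x + y) = base x + base y" "base (x - y) = base x - base y"
  "base (r *\<^sub>R x) = r *\<^sub>R base x" "base e = 0"
  using linear_base by (simp_all add: linear_add linear_diff linear_scale) (simp add: base_def)

lemma base_S [simp]: "z \<in> S \<Longrightarrow> base z = z"
  by (simp add: base_def m_S)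

lemma decompose: "x = base x + m x *\<^sub>R e"
  by (simp add: base_def)

lemma h_affine: "h ((1 - u) *\<^sub>R x + u *\<^sub>R y) = (1 - u) * h x + u * h y"
  by (simp add: h_eq algebra_simps)

lemma mem_prism [simp]: "z \<in> S \<Longrightarrow> z + t *\<^sub>R e \<in> prism \<longleftrightarrow> 0 \<le> t \<and> t \<le> h z"
  by (simp add: prism_def m_S)

lemma S_subset_prism: "S \<subseteq> prism"
  using h_nonneg by (auto simp: prism_def m_S)

lemma convex_prism: "convex prism"
  unfolding convex_alt
proof (intro allI ballI impI, elim conjE)
  fix x y u assume x: "x \<in> prism" and y: "y \<in> prism" and u: "0 \<le> u" "u \<le> (1::real)"
  let ?w = "(1 - u) *\<^sub>R x + u *\<^sub>R y"
  have "base ?w \<in> S"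
    using convex_S x y u by (simp add: prism_def convex_alt)
  moreover have "0 \<le> m ?w" using x y u by (simp add: prism_def)
  moreover have "m ?w \<le> h (base ?w)"
    using x y u by (simp add: prism_def h_affine add_mono mult_left_mono)
  ultimately show "?w \<in> prism" by (simp add: prism_def)
qed

lemma S_face_of_prism: "S face_of prism"
proof -
  have "{x \<in> prism. m x = 0} face_of prism"
    by (rule face_of_zeros_of_nonneg_affine[OF convex_prism]) (auto simp: prism_def)
  moreover have "{x \<in> prism. m x = 0} = S"
    using S_subset_prism m_S by (auto simp: prism_def base_def)
  ultimately show ?thesis by simp
qed

definition roof where
  "roof = {x \<in> prism. h (base x) - m x = 0}"

lemma roof_face_of_prism: "roof face_of prism"
  unfolding roof_def
  by (rule face_of_zeros_of_nonneg_affine[OF convex_prism])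
    (simp_all add: prism_def h_affine right_diff_distrib)

definition over :: "'a set \<Rightarrow> 'a set" where
  "over C = {x \<in> prism. base x \<in> C}"

text \<open>The nondegenerate fibre over \<open>z\<close> makes \<open>e\<close> a direction of
  \<open>over C\<close>. It is independent of the directions of \<open>C\<close>, on which
  \<open>m\<close> vanishes, so exactly one dimension is gained.\<close>

lemma affine_dim_over:
  assumes C: "C \<subseteq> S" and z: "z \<in> C" "h z > 0" and T: "finite T" "S \<subseteq> span T"
  shows "affine_dim (over C) = affine_dim C + 1"
proof -
  have CS: "C \<subseteq> over C" using C S_subset_prism by (auto simp: over_def)
  have eD: "e \<in> span (differences (over C))"
  proof -
    have "z + h z *\<^sub>R e \<in> over C" "z \<in> over C"
      using C z CS by (auto simp: over_def subset_iff)
    then have "h z *\<^sub>R e \<in> differences (over C)"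
      unfolding differences_def by (smt (verit) CollectI add_diff_cancel_left')
    then have "(1 / h z) *\<^sub>R (h z *\<^sub>R e) \<in> span (differences (over C))"
      by (intro span_scale span_base)
    then show ?thesis using z by simp
  qed
  have "differences (over C) \<subseteq> span (insert e (differences C))"
  proof
    fix d assume "d \<in> differences (over C)"
    then obtain x y where xy: "x \<in> over C" "y \<in> over C" "d = x - y"
      unfolding differences_def by blast
    have "d = (base x - base y) + (m x - m y) *\<^sub>R e"
      using xy by (simp add: base_def algebra_simps)
    moreover have "base x - base y \<in> differences C"
      using xy by (auto simp: differences_def over_def)
    ultimately show "d \<in> span (insert e (differences C))"
      by (auto intro!: span_add span_scale intro: span_base)
  qed
  moreover have "insert e (differences C) \<subseteq> span (differences (over C))"
    using eD CS by (auto simp: differences_def intro!: span_base)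
  ultimately have "span (differences (over C)) = span (insert e (differences C))"
    by (simp add: span_eq)
  then have "dim (differences (over C)) = dim (insert e (differences C))" by (rule span_eq_dim)
  also have "\<dots> = dim (differences C) + 1"
  proof (rule dim_insert_outside_span[OF _ T(1)])
    have "span (differences C) \<subseteq> {x. m x = 0}"
      using C m_S by (intro span_minimal subspaceI) (auto simp: differences_def subset_iff linear_0[OF linear_m])
    then show "e \<notin> span (differences C)" by auto
    show "differences C \<subseteq> span T" using C T by (auto simp: differences_def intro!: span_diff)
  qed
  finally show ?thesis using z CS by (auto simp: affine_dim_differences)
qed

text \<open>A face meeting the open prism strictly between bottom and roof contains a whole vertical
  fibre through every one of its points: average such a point with one strictly in between.\<close>

lemma face_meeting_interior_is_over:
  assumes F: "F face_of prism" and x: "x \<in> F" "0 < m x" "m x < h (base x)"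
  shows "F = over (base ` F)" "base ` F face_of S"
proof -
  have FQ: "F \<subseteq> prism" using F by (rule face_of_imp_subset)
  \<comment> \<open>A point strictly inside its own fibre lies in the open segment between the two
    ends, so \<open>F\<close> contains both ends and all between them.\<close>
  have fibre: "base y + t *\<^sub>R e \<in> F"
    if y: "y \<in> F" "0 < m y" "m y < h (base y)" and t: "0 \<le> t" "t \<le> h (base y)" for y t
  proof -
    have bS: "base y \<in> S" using y FQ by (auto simp: prism_def)
    have ends: "base y + 0 *\<^sub>R e \<in> prism" "base y + h (base y) *\<^sub>R e \<in> prism"
      using bS h_nonneg by (auto simp del: scaleR_zero_left)
    have "e \<noteq> 0" using m_e linear_0[OF linear_m] by force
    then have "y \<in> open_segment (base y) (base y + h (base y) *\<^sub>R e)"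
      unfolding in_segment using y
      by (auto intro!: exI[of _ "m y / h (base y)"] simp: algebra_simps base_def)
    then have "base y \<in> F \<and> base y + h (base y) *\<^sub>R e \<in> F"
      using face_ofD[OF F _ _ _ y(1)] ends by auto
    moreover have "base y + t *\<^sub>R e =
        (1 - t / h (base y)) *\<^sub>R base y + (t / h (base y)) *\<^sub>R (base y + h (base y) *\<^sub>R e)"
      using y by (simp add: algebra_simps)
    ultimately show ?thesis
      using face_of_imp_convex[OF F] t y by (simp add: convex_alt)
  qed
  \<comment> \<open>For arbitrary \<open>y\<close> in \<open>F\<close>, the midpoint
    \<open>w\<close> of \<open>x\<close> and \<open>y\<close> is strictly between bottom and roof,
    so its fibre lies in \<open>F\<close>. That fibre contains the midpoint \<open>w'\<close> of
    \<open>x\<close> and the target point, and the face property then yields the target. The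
    excluded case is a degenerate segment.\<close>
  have lift: "base y + t *\<^sub>R e \<in> F" if y: "y \<in> F" and t: "0 \<le> t" "t \<le> h (base y)" for y t
  proof (cases "base y + t *\<^sub>R e = x")
    case False
    define w where "w = (1 - 1/2) *\<^sub>R x + (1/2) *\<^sub>R y"
    define w' where "w' = (1 - 1/2) *\<^sub>R x + (1/2) *\<^sub>R (base y + t *\<^sub>R e)"
    have yQ: "base y \<in> S" "0 \<le> m y" "m y \<le> h (base y)" using y FQ by (auto simp: prism_def)
    have mb: "m (base y) = 0" "base (base y) = base y" using yQ m_S by auto
    have hw: "h (base w) = (1 - 1/2) * h (base x) + (1/2) * h (base y)"
      unfolding w_def using h_affine[of "1/2" "base x" "base y"] by simp
    have "w \<in> F"
      unfolding w_def using x y by (intro convexD_alt face_of_imp_convex[OF F]) auto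
    moreover have "0 < m w" using x yQ by (simp add: w_def)
    moreover have "m w < h (base w)" unfolding hw using x yQ by (simp add: w_def)
    moreover have "m w' \<ge> 0" using x t mb by (simp add: w'_def)
    moreover have "m w' \<le> h (base w)" unfolding hw using x t mb by (simp add: w'_def)
    ultimately have "base w + m w' *\<^sub>R e \<in> F" by (rule fibre)
    moreover have "base w = base w'" using mb by (simp add: w_def w'_def)
    ultimately have "w' \<in> F" using decompose[of w'] by simp
    moreover have "w' \<in> open_segment x (base y + t *\<^sub>R e)"
      unfolding in_segment w'_def using False by (auto intro!: exI[of _ "1/2"])
    moreover have "x \<in> prism" "base y + t *\<^sub>R e \<in> prism" using x FQ yQ t by auto
    ultimately show ?thesis using face_ofD[OF F] by blast
  qed (use x in auto)
  show over: "F = over (base ` F)"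
  proof
    show "F \<subseteq> over (base ` F)" using FQ by (auto simp: over_def)
    show "over (base ` F) \<subseteq> F"
    proof
      fix y assume "y \<in> over (base ` F)"
      then obtain w where "w \<in> F" "base y = base w" "0 \<le> m y" "m y \<le> h (base y)"
        by (auto simp: over_def prism_def)
      then show "y \<in> F" using lift[of w "m y"] decompose[of y] by simp
    qed
  qed
  show "base ` F face_of S"
    unfolding face_of_def
  proof (intro conjI ballI impI)
    show "base ` F \<subseteq> S" using FQ by (auto simp: prism_def)
    show "convex (base ` F)" using linear_base face_of_imp_convex[OF F] by (rule convex_linear_image)
  next
    fix a b z assume a: "a \<in> S" and b: "b \<in> S" and z: "z \<in> base ` F" "z \<in> open_segment a b"
    obtain y where y: "y \<in> F" "z = base y" using z by blast
    \<comment> \<open>The bottom end of the fibre is in \<open>F\<close>, so a segment in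
      \<open>S\<close> through it can be tested against the face property of
      \<open>F\<close>.\<close>
    have "z \<in> F" using lift[OF y(1), of 0] y FQ h_nonneg by (auto simp: prism_def)
    then have "a \<in> F \<and> b \<in> F" using face_ofD[OF F z(2)] a b S_subset_prism by blast
    then show "a \<in> base ` F" "b \<in> base ` F" using a b by (metis base_S imageI)+
  qed
qed

text \<open>A facet inside the bottom or the roof equals it. Any other facet has a point off the
  bottom and a point off the roof; their midpoint lies strictly between the two, so the facet is
  \<open>over\<close> a face of \<open>S\<close>, which is a facet by comparing dimensions.\<close>

lemma num_facets_prism:
  assumes "polytope S"
  shows "num_facets prism \<le> num_facets S + 2"
proof (cases "\<forall>z\<in>S. h z = 0")
  \<comment> \<open>All fibres are single points: the prism is \<open>S\<close> and gains no
    dimension, so this case is kept apart from the dimension count.\<close>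
  case True
  have "prism = S"
  proof
    show "prism \<subseteq> S"
    proof
      fix x assume "x \<in> prism"
      then have "base x \<in> S" "m x = 0" using True by (auto simp: prism_def)
      then show "x \<in> S" using decompose[of x] by simp
    qed
  qed (rule S_subset_prism)
  then show ?thesis by simp
next
  case False
  then obtain z0 where z0: "z0 \<in> S" "h z0 > 0" using h_nonneg by force
  obtain V where V: "finite V" "S = convex hull V" using assms by (auto simp: polytope_def)
  have T: "finite V" "S \<subseteq> span V" using V convex_hull_subset_span by auto
  have T': "finite (insert e V)" "prism \<subseteq> span (insert e V)"
  proof -
    show "prism \<subseteq> span (insert e V)"
    proof
      fix x assume "x \<in> prism"
      then have "base x \<in> span (insert e V)"
        using T span_mono[of V "insert e V"] by (auto simp: prism_def)
      then have "base x + m x *\<^sub>R e \<in> span (insert e V)"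
        by (intro span_add span_scale) (auto intro: span_base)
      then show "x \<in> span (insert e V)" using decompose[of x] by simp
    qed
  qed (use V in simp)
  have over_S: "over S = prism" by (auto simp: over_def prism_def)
  have dim_prism: "affine_dim prism = affine_dim S + 1"
    using affine_dim_over[OF subset_refl z0 T] over_S by simp
  \<comment> \<open>The top and bottom ends of the fibre over \<open>z0\<close> witness that the
    bottom and the roof are proper faces.\<close>
  have z0_lift: "z0 + h z0 *\<^sub>R e \<in> prism" "z0 + h z0 *\<^sub>R e \<notin> S"
    using z0 m_S h_nonneg by (auto dest: m_S)
  have z0_bot: "z0 \<in> prism" "z0 \<notin> roof"
    using z0 S_subset_prism by (auto simp: roof_def m_S)
  \<comment> \<open>A strict chain \<open>F\<close>, \<open>B\<close>, \<open>prism\<close> of faces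
    would lose at least two dimensions, but a facet loses only one.\<close>
  have eq_if_subset: "F = B"
    if F: "is_facet F prism" and B: "B face_of prism" "B \<noteq> prism" "F \<subseteq> B" for F B
  proof (rule ccontr)
    assume "F \<noteq> B"
    have BQ: "B \<subseteq> prism" using B by (simp add: face_of_imp_subset)
    have "F face_of B" using F B BQ by (auto simp: is_facet_def intro: face_of_subset)
    then have "affine_dim F < affine_dim B"
      using affine_dim_face_less[OF _ face_of_imp_convex[OF B(1)] \<open>F \<noteq> B\<close> T'(1)] BQ T' by blast
    moreover have "affine_dim B < affine_dim prism"
      using affine_dim_face_less[OF B(1) convex_prism B(2) T'] .
    ultimately show False using F by (simp add: is_facet_def)
  qed
  have "{F. is_facet F prism} \<subseteq> {S, roof} \<union> over ` {C. is_facet C S}"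
  proof (intro subsetI, unfold mem_Collect_eq)
    fix F assume F: "is_facet F prism"
    have Ff: "F face_of prism" and FQ: "F \<subseteq> prism" and Fne: "F \<noteq> {}"
      using F face_of_imp_subset by (auto simp: is_facet_def)
    consider "F \<subseteq> S" | "F \<subseteq> roof" | "\<not> F \<subseteq> S" "\<not> F \<subseteq> roof" by blast
    then show "F \<in> {S, roof} \<union> over ` {C. is_facet C S}"
    proof cases
      case 1
      then show ?thesis using eq_if_subset[OF F S_face_of_prism] z0_lift by blast
    next
      case 2
      then show ?thesis using eq_if_subset[OF F roof_face_of_prism] z0_bot by blast
    next
      case 3
      obtain x where x: "x \<in> F" "x \<notin> S" using 3 by blast
      obtain y where y: "y \<in> F" "y \<notin> roof" using 3 by blast
      define w where "w = (1 - 1/2) *\<^sub>R x + (1/2) *\<^sub>R y"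
      have wF: "w \<in> F"
        unfolding w_def using x y by (intro convexD_alt face_of_imp_convex[OF Ff]) auto
      have xQ: "base x \<in> S" "0 \<le> m x" "m x \<le> h (base x)" using x FQ by (auto simp: prism_def)
      have yQ: "base y \<in> S" "0 \<le> m y" "m y \<le> h (base y)" using y FQ by (auto simp: prism_def)
      have "m x \<noteq> 0" using x xQ decompose[of x] by auto
      moreover have "m y \<noteq> h (base y)" using y FQ by (auto simp: roof_def)
      moreover have "h (base w) = (1 - 1/2) * h (base x) + (1/2) * h (base y)"
        unfolding w_def using h_affine[of "1/2" "base x" "base y"] by simp
      ultimately have w: "0 < m w" "m w < h (base w)"
        using xQ yQ by (simp_all add: w_def)
      note over = face_meeting_interior_is_over[OF Ff wF w]
      have "affine_dim F = affine_dim (base ` F) + 1"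
        using affine_dim_over[OF face_of_imp_subset[OF over(2)] imageI[OF wF] _ T] w over(1) by auto
      \<comment> \<open>Both \<open>F\<close> over its base and \<open>prism\<close> over
        \<open>S\<close> gain exactly one dimension, so codimension one is preserved.\<close>
      then have "is_facet (base ` F) S"
        using over(2) F Fne dim_prism by (simp add: is_facet_def)
      then show ?thesis using over(1) by blast
    qed
  qed
  moreover have fin: "finite {C. is_facet C S}"
    by (rule finite_subset[OF _ finite_faces_of_polytope[OF assms]]) (auto simp: is_facet_def)
  ultimately have "card {F. is_facet F prism} \<le> card ({S, roof} \<union> over ` {C. is_facet C S})"
    by (intro card_mono) auto
  also have "\<dots> \<le> card {S, roof} + card (over ` {C. is_facet C S})" by (rule card_Un_le)
  also have "\<dots> \<le> 2 + card {C. is_facet C S}"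
    using card_image_le[OF fin, of over] by (intro add_mono) (auto simp: card_insert_if)
  finally show ?thesis by (simp add: num_facets_def)
qed


section \<open>Generators and vertices of the prism\<close>

lemma polytope_prism:
  assumes "polytope S"
  shows "polytope prism"
proof -
  obtain V where V: "finite V" "S = convex hull V" using assms by (auto simp: polytope_def)
  define lift where "lift z = z + h z *\<^sub>R e" for z
  define L where "L z = z - g z *\<^sub>R e" for z
  have L: "linear L" unfolding L_def by (rule linearI) (simp_all add: algebra_simps)
  have lift_L: "lift = (\<lambda>z. c *\<^sub>R e + L z)" by (auto simp: lift_def L_def h_eq algebra_simps)
  have lift_S: "lift ` S = convex hull (lift ` V)"
  proof -
    have "lift ` S = (+) (c *\<^sub>R e) ` (L ` (convex hull V))"
      unfolding lift_L V by (simp add: image_image)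
    also have "\<dots> = convex hull ((+) (c *\<^sub>R e) ` (L ` V))"
      by (simp add: convex_hull_linear_image[OF L] convex_hull_translation)
    finally show ?thesis unfolding lift_L by (simp add: image_image)
  qed
  \<comment> \<open>\<open>lift\<close> is affine, so the lifted copy of \<open>S\<close> is the
    hull of the lifted generators. Every point of the prism lies on the vertical segment from its
    base to the lift of its base.\<close>
  have "prism = convex hull (V \<union> lift ` V)"
  proof
    show "convex hull (V \<union> lift ` V) \<subseteq> prism"
    proof (rule hull_minimal)
      have VS: "V \<subseteq> S" unfolding V(2) by (rule hull_subset)
      have "lift z \<in> prism" if "z \<in> V" for z
        using that VS h_nonneg[of z] by (auto simp: lift_def)
      then show "V \<union> lift ` V \<subseteq> prism"
        using VS S_subset_prism by blast
    qed (rule convex_prism)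
    show "prism \<subseteq> convex hull (V \<union> lift ` V)"
    proof
      fix x assume x: "x \<in> prism"
      let ?z = "base x"
      have z: "?z \<in> S" "0 \<le> m x" "m x \<le> h ?z" using x by (auto simp: prism_def)
      have zV: "?z \<in> convex hull (V \<union> lift ` V)"
        using z V hull_mono[of V "V \<union> lift ` V" convex] by auto
      have lV: "lift ?z \<in> convex hull (V \<union> lift ` V)"
        using z lift_S hull_mono[of "lift ` V" "V \<union> lift ` V" convex] by auto
      show "x \<in> convex hull (V \<union> lift ` V)"
      proof (cases "h ?z = 0")
        case True
        then show ?thesis using z zV decompose[of x] by simp
      next
        case False
        have "(1 - m x / h ?z) *\<^sub>R ?z + (m x / h ?z) *\<^sub>R lift ?z = ?z + m x *\<^sub>R e"
          using False by (simp add: lift_def algebra_simps)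
        then have "x = (1 - m x / h ?z) *\<^sub>R ?z + (m x / h ?z) *\<^sub>R lift ?z"
          using decompose[of x] by simp
        moreover have "\<dots> \<in> convex hull (V \<union> lift ` V)"
          using z False by (intro convexD_alt zV lV) (auto simp: divide_simps)
        ultimately show ?thesis by simp
      qed
    qed
  qed
  moreover have "finite (V \<union> lift ` V)" using V by simp
  ultimately show ?thesis unfolding polytope_def by blast
qed

lemma extreme_point_of_prism_bottom:
  "z extreme_point_of S \<Longrightarrow> z extreme_point_of prism"
  using extreme_point_of_face[OF S_face_of_prism] by blast

text \<open>On the roof the height is determined by the base, so \<open>base\<close> is injective
  there. A segment of the roof through the lifted vertex would project to a nondegenerate segment of
  \<open>S\<close> through \<open>z\<close>.\<close>

lemma extreme_point_of_prism_roof: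
  assumes z: "z extreme_point_of S"
  shows "z + h z *\<^sub>R e extreme_point_of prism"
proof -
  have zS: "z \<in> S" using z by (simp add: extreme_point_of_def)
  have "z + h z *\<^sub>R e extreme_point_of roof"
    unfolding extreme_point_of_def
  proof (intro conjI ballI notI)
    show "z + h z *\<^sub>R e \<in> roof" using zS h_nonneg by (simp add: roof_def m_S)
  next
    fix x y assume x: "x \<in> roof" and y: "y \<in> roof" and seg: "z + h z *\<^sub>R e \<in> open_segment x y"
    obtain u where u: "x \<noteq> y" "0 < u" "u < 1" "z + h z *\<^sub>R e = (1 - u) *\<^sub>R x + u *\<^sub>R y"
      using seg by (auto simp: in_segment)
    have xS: "base x \<in> S" "base y \<in> S" using x y by (auto simp: roof_def prism_def)
    have "base (z + h z *\<^sub>R e) = (1 - u) *\<^sub>R base x + u *\<^sub>R base y" using u by simp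
    then have zb: "z = (1 - u) *\<^sub>R base x + u *\<^sub>R base y" using zS by simp
    have "base x \<noteq> base y"
    proof
      assume "base x = base y"
      moreover have "m x = m y" using x y calculation by (simp add: roof_def)
      ultimately show False using u decompose[of x] decompose[of y] by simp
    qed
    then have "z \<in> open_segment (base x) (base y)" using u zb by (auto simp: in_segment)
    then show False using z xS by (simp add: extreme_point_of_def)
  qed
  then show ?thesis using extreme_point_of_face[OF roof_face_of_prism] by blast
qed

text \<open>A vertex is a singleton face, so strictly between bottom and roof it would have to
  contain its whole fibre. If its base were inside a segment of \<open>S\<close>, that segment, kept
  at the bottom or lifted to the roof by the affine \<open>h\<close>, would contain the
  vertex.\<close>

lemma extreme_point_of_prismD:
  assumes w: "w extreme_point_of prism"
  shows "base w extreme_point_of S" "m w = 0 \<or> m w = h (base w)"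
proof -
  have wQ: "w \<in> prism" using w by (simp add: extreme_point_of_def)
  then have bS: "base w \<in> S" "0 \<le> m w" "m w \<le> h (base w)" by (auto simp: prism_def)
  show mw: "m w = 0 \<or> m w = h (base w)"
  proof (rule ccontr)
    assume "\<not> ?thesis"
    then have less: "0 < m w" "m w < h (base w)" using bS by auto
    have "{w} = over (base ` {w})"
      using w less face_of_singleton[of w prism] by (intro face_meeting_interior_is_over) auto
    moreover have "base w \<in> over (base ` {w})"
      using bS S_subset_prism by (auto simp: over_def)
    ultimately have "base w = w" by (metis singletonD)
    then show False using less m_S[OF bS(1)] by simp
  qed
  show "base w extreme_point_of S"
    unfolding extreme_point_of_def
  proof (intro conjI ballI notI)
    fix x y assume x: "x \<in> S" and y: "y \<in> S" and seg: "base w \<in> open_segment x y"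
    obtain u where u: "x \<noteq> y" "0 < u" "u < 1" "base w = (1 - u) *\<^sub>R x + u *\<^sub>R y"
      using seg by (auto simp: in_segment)
    show False using mw
    proof
      assume "m w = 0"
      then have "w = base w" using decompose[of w] by simp
      then show False using w seg x y S_subset_prism by (auto simp: extreme_point_of_def)
    next
      assume mw: "m w = h (base w)"
      let ?x = "x + h x *\<^sub>R e" and ?y = "y + h y *\<^sub>R e"
      have "?x \<in> prism" "?y \<in> prism" using x y h_nonneg by auto
      moreover have "base ?x \<noteq> base ?y" using u x y by simp
      then have "?x \<noteq> ?y" by metis
      moreover have "h (base w) = (1 - u) * h x + u * h y" unfolding u(4) by (rule h_affine)
      then have "w = ((1 - u) *\<^sub>R x + u *\<^sub>R y) + ((1 - u) * h x + u * h y) *\<^sub>R e"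
        using decompose[of w] mw u(4) by simp
      then have "w = (1 - u) *\<^sub>R ?x + u *\<^sub>R ?y"
        by (simp add: algebra_simps)
      ultimately show False using w u unfolding extreme_point_of_def in_segment by blast
    qed
  qed (rule bS)
qed

end

subsection \<open>Coordinates\<close>

lemma lookup_scaleR [simp]: "Poly_Mapping.lookup (r *\<^sub>R x) i = r *\<^sub>R Poly_Mapping.lookup x i"
  for x :: "'b \<Rightarrow>\<^sub>0 'c::real_vector"
proof -
  have "finite {i. r *\<^sub>R Poly_Mapping.lookup x i \<noteq> 0}"
    by (rule finite_subset[OF _ finite_keys[of x]]) (auto simp: in_keys_iff)
  then show ?thesis by (simp add: scaleR_poly_mapping_def Abs_poly_mapping_inverse)
qed

lemma linear_lookup: "linear (\<lambda>x :: 'b \<Rightarrow>\<^sub>0 real. Poly_Mapping.lookup x i)"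
  by (rule linearI) (simp_all add: lookup_add)

lemma coord_space_iff: "x \<in> coord_space q \<longleftrightarrow> (\<forall>i\<ge>q. Poly_Mapping.lookup x i = 0)"
  by (auto simp: coord_space_def in_keys_iff subset_iff not_le[symmetric])

lemma coord_space_expansion:
  assumes "x \<in> coord_space q"
  shows "x = (\<Sum>i<q. Poly_Mapping.lookup x i *\<^sub>R Poly_Mapping.single i 1)"
proof (rule poly_mapping_eqI)
  fix k
  have "(\<Sum>i<q. Poly_Mapping.lookup x i * (1 when i = k)) = (if k < q then Poly_Mapping.lookup x k else 0)"
    by (simp add: when_def sum.delta' if_distrib cong: if_cong)
  then show "Poly_Mapping.lookup x k =
      Poly_Mapping.lookup (\<Sum>i<q. Poly_Mapping.lookup x i *\<^sub>R Poly_Mapping.single i 1) k"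
    using assms by (simp add: lookup_sum lookup_single coord_space_iff)
qed

text \<open>The inequalities of \<open>S\<close> are kept, blind to the new coordinate, and two are
  added: one for the bottom and one for the roof.\<close>

lemma polyhedron_in_prism:
  fixes g :: "(nat \<Rightarrow>\<^sub>0 real) \<Rightarrow> real"
  assumes S: "polyhedron_in q S" and g: "linear g"
  defines "base \<equiv> \<lambda>x. x - Poly_Mapping.lookup x q *\<^sub>R Poly_Mapping.single q (1::real)"
  shows "polyhedron_in (Suc q)
    {x. base x \<in> S \<and> 0 \<le> Poly_Mapping.lookup x q \<and> Poly_Mapping.lookup x q \<le> c - g (base x)}"
proof -
  obtain A :: "((nat \<Rightarrow> real) \<times> real) set" where A: "finite A"
    "S = {x \<in> coord_space q. \<forall>(k, b) \<in> A. (\<Sum>i<q. k i * Poly_Mapping.lookup x i) \<le> b}"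
    using S unfolding polyhedron_in_def by blast
  define k1 :: "nat \<Rightarrow> real" where "k1 = (\<lambda>i. if i = q then -1 else 0)"
  \<comment> \<open>On the coordinate space the linear \<open>g\<close> is given by its values at
    the unit vectors; the coefficient 1 at \<open>q\<close> turns the roof condition into
    \<open>g (base x) + x_q \<le> c\<close>.\<close>
  define k2 where "k2 = (\<lambda>i. if i = q then 1 else g (Poly_Mapping.single i 1))"
  \<comment> \<open>The entry \<open>k q\<close> is arbitrary, because the sums describing
    \<open>S\<close> stop before \<open>q\<close>; it has to be reset to 0 now that they include
    \<open>q\<close>.\<close>
  define A' where "A' = (\<lambda>(k, b). (k(q := 0), b)) ` A \<union> {(k1, 0), (k2, c)}"
  have base_coord: "base x \<in> coord_space q \<longleftrightarrow> x \<in> coord_space (Suc q)" for x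
    unfolding coord_space_iff base_def
    by (auto simp: lookup_minus lookup_single when_def Suc_le_eq)
  have lookup_base: "Poly_Mapping.lookup (base x) i = Poly_Mapping.lookup x i" if "i < q" for x i
    using that by (simp add: base_def lookup_minus lookup_single when_def)
  have old: "(\<Sum>i<Suc q. (k(q := 0)) i * Poly_Mapping.lookup x i)
      = (\<Sum>i<q. k i * Poly_Mapping.lookup (base x) i)" for k x
    by (simp add: lookup_base)
  have bottom: "(\<Sum>i<Suc q. k1 i * Poly_Mapping.lookup x i) = - Poly_Mapping.lookup x q" for x
    by (simp add: k1_def)
  have roof: "(\<Sum>i<Suc q. k2 i * Poly_Mapping.lookup x i) = g (base x) + Poly_Mapping.lookup x q"
    if "x \<in> coord_space (Suc q)" for x
  proof -
    have "g (base x) = (\<Sum>i<q. Poly_Mapping.lookup (base x) i * g (Poly_Mapping.single i 1))"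
    proof -
      have "base x \<in> coord_space q" using base_coord that by simp
      then have "g (base x) = g (\<Sum>i<q. Poly_Mapping.lookup (base x) i *\<^sub>R Poly_Mapping.single i 1)"
        by (rule arg_cong[OF coord_space_expansion])
      also have "\<dots> = (\<Sum>i<q. g (Poly_Mapping.lookup (base x) i *\<^sub>R Poly_Mapping.single i 1))"
        by (rule linear_sum[OF g])
      finally show ?thesis by (simp only: linear_scale[OF g] real_scaleR_def)
    qed
    also have "\<dots> = (\<Sum>i<q. k2 i * Poly_Mapping.lookup x i)"
      by (intro sum.cong) (auto simp: lookup_base k2_def)
    finally show ?thesis by (simp add: k2_def)
  qed
  have "{x. base x \<in> S \<and> 0 \<le> Poly_Mapping.lookup x q \<and> Poly_Mapping.lookup x q \<le> c - g (base x)}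
    = {x \<in> coord_space (Suc q). \<forall>(k, b) \<in> A'. (\<Sum>i<Suc q. k i * Poly_Mapping.lookup x i) \<le> b}"
  proof (intro set_eqI iffI; unfold mem_Collect_eq; elim conjE; intro conjI)
    fix x
    assume x: "base x \<in> S" "0 \<le> Poly_Mapping.lookup x q" "Poly_Mapping.lookup x q \<le> c - g (base x)"
    show xc: "x \<in> coord_space (Suc q)" using x A base_coord by simp
    show "\<forall>(k, b) \<in> A'. (\<Sum>i<Suc q. k i * Poly_Mapping.lookup x i) \<le> b"
      using x A unfolding A'_def
      by (auto simp del: sum.lessThan_Suc fun_upd_apply simp: old bottom roof[OF xc])
  next
    fix x
    assume xc: "x \<in> coord_space (Suc q)"
      and x: "\<forall>(k, b) \<in> A'. (\<Sum>i<Suc q. k i * Poly_Mapping.lookup x i) \<le> b"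
    show "base x \<in> S" using x xc A base_coord unfolding A'_def
      by (fastforce simp del: sum.lessThan_Suc fun_upd_apply simp: old)
    show "0 \<le> Poly_Mapping.lookup x q" "Poly_Mapping.lookup x q \<le> c - g (base x)"
      using x unfolding A'_def
      by (auto simp del: sum.lessThan_Suc fun_upd_apply simp: old bottom roof[OF xc])
  qed
  moreover have "finite A'" using A by (simp add: A'_def)
  ultimately show ?thesis unfolding polyhedron_in_def by blast
qed

subsection \<open>0/1-polytopes and symmetries of the cube\<close>

text \<open>By Minkowski's theorem the polytope is the hull of its vertices, and these lie in the
  convex cube.\<close>

lemma zero_one_polytope_subset_cube:
  assumes "zero_one_polytope P"
  shows "P \<subseteq> {x. \<forall>i. 0 \<le> x $ i \<and> x $ i \<le> 1}"
proof -
  have "P = convex hull {x. x extreme_point_of P}"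
    using assms by (intro Krein_Milman_Minkowski)
      (auto simp: zero_one_polytope_def polytope_imp_compact polytope_imp_convex)
  also have "\<dots> \<subseteq> {x. \<forall>i. 0 \<le> x $ i \<and> x $ i \<le> 1}"
  proof (rule hull_minimal)
    show "{x. x extreme_point_of P} \<subseteq> {x. \<forall>i. 0 \<le> x $ i \<and> x $ i \<le> 1}"
    proof
      fix v assume "v \<in> {x. x extreme_point_of P}"
      then have "v $ i = 0 \<or> v $ i = 1" for i
        using assms by (auto simp: zero_one_polytope_def)
      then have "0 \<le> v $ i \<and> v $ i \<le> 1" for i
        by (metis order_refl zero_le_one)
      then show "v \<in> {x. \<forall>i. 0 \<le> x $ i \<and> x $ i \<le> 1}" by simp
    qed
    have "{x :: real^'a. \<forall>i. 0 \<le> x $ i \<and> x $ i \<le> 1} = cbox 0 1"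
      by (auto simp: mem_box_cart)
    then show "convex {x :: real^'a. \<forall>i. 0 \<le> x $ i \<and> x $ i \<le> 1}"
      using convex_box(1) by simp
  qed
  finally show ?thesis .
qed

text \<open>In each coordinate, a proper convex combination of numbers in [0, 1] reaches 0 or 1 only
  if both numbers agree. This later shows that vertices of the prism project to vertices.\<close>

lemma zero_one_point_extreme:
  assumes P: "zero_one_polytope P" and v: "v \<in> P" "\<And>i. v $ i \<in> {0, 1}"
  shows "v extreme_point_of P"
  unfolding extreme_point_of_def
proof (intro conjI ballI notI)
  fix x y assume xy: "x \<in> P" "y \<in> P" and seg: "v \<in> open_segment x y"
  obtain u where u: "x \<noteq> y" "0 < u" "u < 1" "v = (1 - u) *\<^sub>R x + u *\<^sub>R y"
    using seg by (auto simp: in_segment)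
  have "x $ i = y $ i" for i
  proof -
    have c: "0 \<le> x $ i" "x $ i \<le> 1" "0 \<le> y $ i" "y $ i \<le> 1"
      using zero_one_polytope_subset_cube[OF P] xy by auto
    have vi: "v $ i = (1 - u) * x $ i + u * y $ i" using u by simp
    have pos: "0 \<le> (1 - u) * x $ i" "0 \<le> u * y $ i" "0 \<le> (1 - u) * (1 - x $ i)" "0 \<le> u * (1 - y $ i)"
      using c u by auto
    from v(2)[of i] consider "v $ i = 0" | "v $ i = 1" by auto
    then show ?thesis
    proof cases
      case 1
      then have "(1 - u) * x $ i = 0 \<and> u * y $ i = 0" using vi pos by linarith
      then show ?thesis using u by auto
    next
      case 2
      then have "(1 - u) * (1 - x $ i) + u * (1 - y $ i) = 0" using vi by (simp add: algebra_simps)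
      then have "(1 - u) * (1 - x $ i) = 0 \<and> u * (1 - y $ i) = 0" using pos by linarith
      then show ?thesis using u by auto
    qed
  qed
  then show False using u by (simp add: vec_eq_iff)
qed (rule v)

lemma inner_reflection:
  assumes "a \<noteq> 0"
  shows "a \<bullet> reflection a \<beta> x = 2 * \<beta> - a \<bullet> x"
  using assms by (simp add: reflection_def inner_add_right power2_norm_eq_inner)

lemma reflection_reflection:
  assumes "a \<noteq> 0"
  shows "reflection a \<beta> (reflection a \<beta> x) = x"
  unfolding reflection_def[of a \<beta> "reflection a \<beta> x"] inner_reflection[OF assms]
  by (simp add: reflection_def scaleR_left_distrib[symmetric] add_divide_distrib[symmetric])

lemma reflection_convex_combination:
  "reflection a \<beta> ((1 - u) *\<^sub>R x + u *\<^sub>R y) = (1 - u) *\<^sub>R reflection a \<beta> x + u *\<^sub>R reflection a \<beta> y"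
proof -
  define s where "s z = 2 * ((\<beta> - a \<bullet> z) / (norm a)\<^sup>2)" for z
  have "s ((1 - u) *\<^sub>R x + u *\<^sub>R y) = 2 * (((1 - u) * (\<beta> - a \<bullet> x) + u * (\<beta> - a \<bullet> y)) / (norm a)\<^sup>2)"
    by (simp add: s_def inner_add_right algebra_simps)
  also have "\<dots> = (1 - u) * s x + u * s y"
  proof -
    have "2 * ((p * y + q * z) / n) = p * (2 * (y / n)) + q * (2 * (z / n))" for p q y z n :: real
      by (simp add: add_divide_distrib algebra_simps)
    then show ?thesis unfolding s_def .
  qed
  finally show ?thesis
    unfolding reflection_def s_def[symmetric]
    by (simp add: scaleR_right_distrib scaleR_left_distrib)
qed

text \<open>The two flips differ by the sign \<open>\<sigma>\<close>, the two swaps by exchanging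
  \<open>i\<close> and \<open>j\<close>.\<close>

lemma cube_symmetry_cases:
  assumes "induces_cube_symmetry a \<beta>"
  obtains (flip) i \<sigma> where "a = (2 * \<sigma>) *\<^sub>R axis i 1" "\<beta> = \<sigma>" "\<sigma> = 1 \<or> \<sigma> = - 1"
    | (swap) i j where "i \<noteq> j" "\<beta> = 0" "a = axis i 1 - axis j 1"
  using assms unfolding induces_cube_symmetry_def
proof (elim disjE exE conjE)
  fix i
  show thesis if "a = 2 *\<^sub>R axis i 1" "\<beta> = 1"
    using that by (intro flip[of 1 i]) auto
  show thesis if "a = - (2 *\<^sub>R axis i 1)" "\<beta> = - 1"
    using that by (intro flip[of "- 1" i]) auto
next
  fix i j
  show thesis if "i \<noteq> j" "\<beta> = 0" "a = axis i 1 - axis j 1"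
    using that by (intro swap[of i j])
  show thesis if "i \<noteq> j" "\<beta> = 0" "a = axis j 1 - axis i 1"
    using that by (intro swap[of j i]) auto
qed

lemma cube_symmetry_nonzero:
  assumes "induces_cube_symmetry a \<beta>"
  shows "a \<noteq> 0"
  using assms by (cases rule: cube_symmetry_cases) (auto simp: axis_eq_axis)

text \<open>For a flip the slack is \<open>\<sigma> * (1 - 2 * x $ i)\<close>, which is 1 or -1; for
  a swap it is a difference of two 0/1 values. The half-space excludes -1. Hence the prism has
  height 0 or 1 over each vertex.\<close>

lemma cube_symmetry_slack:
  assumes "induces_cube_symmetry a \<beta>" "\<And>i. x $ i \<in> {0, 1}" "a \<bullet> x \<le> \<beta>"
  shows "\<beta> - a \<bullet> x \<in> {0, 1}"
  using assms(1)
proof (cases rule: cube_symmetry_cases)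
  case (flip i \<sigma>)
  then show ?thesis using assms(2)[of i] assms(3) by (auto simp: inner_axis')
next
  case (swap i j)
  then show ?thesis
    using assms(2)[of i] assms(2)[of j] assms(3) by (auto simp: inner_axis' inner_diff_left)
qed

lemma cube_symmetry_zero_one:
  fixes a x :: "real^'p"
  assumes "induces_cube_symmetry a \<beta>" "\<And>i. x $ i \<in> {0, 1}"
  shows "reflection a \<beta> x $ k \<in> {0, 1}"
proof -
  have coord: "reflection a \<beta> x $ k = x $ k + 2 * ((\<beta> - a \<bullet> x) / (norm a)\<^sup>2) * a $ k"
    by (simp add: reflection_def)
  have axis: "axis i (1::real) $ l = (if l = i then 1 else 0)" for i l :: 'p
    by (simp add: axis_def)
  from assms(1) show ?thesis
  proof (cases rule: cube_symmetry_cases)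
    case (flip i \<sigma>)
    have "(norm a)\<^sup>2 = 4" "a \<bullet> x = 2 * \<sigma> * x $ i" "a $ k = (if k = i then 2 * \<sigma> else 0)"
      using flip by (auto simp: inner_axis' axis power2_eq_square)
    then have "reflection a \<beta> x $ k = (if k = i then 1 - x $ i else x $ k)"
      unfolding coord using flip(2,3) by (auto simp: field_simps)
    then show ?thesis
      using assms(2)[of k] by auto
  next
    case (swap i j)
    have "(norm a)\<^sup>2 = 2" "a \<bullet> x = x $ i - x $ j"
      using swap by (simp_all add: power2_norm_eq_inner inner_diff_left inner_diff_right
          inner_axis' axis)
    moreover have "a $ k = (if k = i then 1 else 0) - (if k = j then 1 else 0)"
      using swap by (simp add: axis)
    ultimately have "reflection a \<beta> x $ k = (if k = i then x $ j else if k = j then x $ i else x $ k)"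
      unfolding coord using swap(1,2) by (auto simp: diff_divide_distrib)
    then show ?thesis
      using assms(2) by simp
  qed
qed


section \<open>The prism as a nice 0/1-extension\<close>

lemma nice_zero_one_extension_reflection:
  fixes P' :: "(real^'p) set"
  assumes sym: "induces_cube_symmetry a \<beta>" and H: "P' \<subseteq> {x. a \<bullet> x \<le> \<beta>}"
    and nice: "nice_zero_one_extension q S \<pi>' P'"
  obtains Q \<pi> where
    "nice_zero_one_extension (Suc q) Q \<pi> (convex hull (P' \<union> reflection a \<beta> ` P'))"
    "num_facets Q \<le> num_facets S + 2"
proof -
  let ?\<phi> = "reflection a \<beta>"
  define P where "P = convex hull (P' \<union> ?\<phi> ` P')"
  define e :: "nat \<Rightarrow>\<^sub>0 real" where "e = Poly_Mapping.single q 1"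
  define m :: "(nat \<Rightarrow>\<^sub>0 real) \<Rightarrow> real" where "m = (\<lambda>x. Poly_Mapping.lookup x q)"
  define g where "g = (\<lambda>z. a \<bullet> \<pi>' z)"
  define h where "h = (\<lambda>z. \<beta> - g z)"
  \<comment> \<open>Scaled so that reflecting a point means moving it by its slack times
    \<open>d\<close>.\<close>
  define d where "d = (2 / (norm a)\<^sup>2) *\<^sub>R a"
  have P'01: "zero_one_polytope P'" and S_poly: "polyhedron_in q S" and lin: "linear \<pi>'"
    and img: "\<pi>' ` S = P'" and S01: "zero_one_polytope_in q S"
    and vert: "\<And>w. w extreme_point_of S \<Longrightarrow> \<pi>' w extreme_point_of P'"
    and ex1: "\<And>v. v extreme_point_of P' \<Longrightarrow> \<exists>!w. w extreme_point_of S \<and> \<pi>' w = v"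
    using nice unfolding nice_zero_one_extension_def is_extension_def by blast+
  have S_coord: "S \<subseteq> coord_space q" and S_polytope: "polytope S"
    and S_vert: "\<And>v i. v extreme_point_of S \<Longrightarrow> i < q \<Longrightarrow> Poly_Mapping.lookup v i \<in> {0, 1}"
    using S01 unfolding zero_one_polytope_in_def by blast+
  have P'_vert: "\<And>v i. v extreme_point_of P' \<Longrightarrow> v $ i \<in> {0, 1}"
    using P'01 unfolding zero_one_polytope_def by blast
  have a: "a \<noteq> 0" using sym by (rule cube_symmetry_nonzero)
  have g: "linear g"
    unfolding g_def using linear_compose[OF lin bounded_linear.linear[OF bounded_linear_inner_right[of a]]]
    by (simp add: o_def)
  \<comment> \<open>Coordinate \<open>q\<close> is the first one vanishing on all of
    \<open>coord_space q\<close>, hence free to measure height. The half-space hypothesis on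
    \<open>P'\<close> is what makes \<open>h\<close> nonnegative.\<close>
  interpret prism_under_affine m g h \<beta> e S
  proof (rule prism_under_affine.intro)
    show "linear m" unfolding m_def by (rule linear_lookup)
    show "m e = 1" by (simp add: m_def e_def)
    show "m z = 0" if "z \<in> S" for z
      using that S_coord by (auto simp: m_def coord_space_iff)
    show "linear g" by (rule g)
    show "h z = \<beta> - g z" for z by (simp add: h_def)
    show "convex S" using S_polytope by (auto simp: polytope_def)
    show "h z \<ge> 0" if "z \<in> S" for z using that img H by (auto simp: h_def g_def)
  qed
  \<comment> \<open>Since \<open>h z\<close> is the slack of \<open>\<pi>' z\<close>, the fibre over
    \<open>z\<close> is mapped onto the segment from \<open>\<pi>' z\<close> to its mirror
    image.\<close>
  define \<pi> where "\<pi> x = \<pi>' (base x) + m x *\<^sub>R d" for x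
  have lin_\<pi>: "linear \<pi>"
    unfolding \<pi>_def
    by (rule linearI) (simp_all add: linear_add[OF lin] linear_scale[OF lin] algebra_simps)
  have \<phi>_eq: "?\<phi> x = x + (\<beta> - a \<bullet> x) *\<^sub>R d" for x
    by (simp add: reflection_def d_def)
  have \<pi>_S: "\<pi> z = \<pi>' z" if "z \<in> S" for z using that by (simp add: \<pi>_def m_S)
  have \<pi>_roof: "\<pi> (z + h z *\<^sub>R e) = ?\<phi> (\<pi>' z)" if "z \<in> S" for z
    using that by (simp add: \<pi>_def m_S \<phi>_eq h_def g_def)
  have P'P: "P' \<subseteq> P" "?\<phi> ` P' \<subseteq> P" unfolding P_def by (simp_all add: hull_inc subset_iff)
  have convex_P: "convex P" unfolding P_def by simp
  have img_\<pi>: "\<pi> ` prism = P"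
  proof
    show "\<pi> ` prism \<subseteq> P"
    proof clarify
      fix x assume x: "x \<in> prism"
      let ?z = "base x"
      have z: "?z \<in> S" "0 \<le> m x" "m x \<le> h ?z" using x by (auto simp: prism_def)
      have in_P: "\<pi>' ?z \<in> P" "?\<phi> (\<pi>' ?z) \<in> P" using z img P'P by auto
      show "\<pi> x \<in> P"
      proof (cases "h ?z = 0")
        case True
        then show ?thesis using z in_P by (simp add: \<pi>_def)
      next
        case False
        have "?\<phi> (\<pi>' ?z) = \<pi>' ?z + h ?z *\<^sub>R d" by (simp add: \<phi>_eq h_def g_def)
        then have \<pi>x: "\<pi> x = (1 - m x / h ?z) *\<^sub>R \<pi>' ?z + (m x / h ?z) *\<^sub>R ?\<phi> (\<pi>' ?z)"
          using False by (simp add: \<pi>_def algebra_simps)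
        show ?thesis
          unfolding \<pi>x
          by (rule convexD_alt[OF convex_P in_P]) (use z False in \<open>auto simp: divide_simps\<close>)
      qed
    qed
    have "P' \<subseteq> \<pi> ` prism"
      using img \<pi>_S S_subset_prism by (metis image_cong image_mono)
    moreover have "?\<phi> ` P' \<subseteq> \<pi> ` prism"
    proof clarify
      fix x assume "x \<in> P'"
      then obtain z where z: "z \<in> S" "x = \<pi>' z" using img by blast
      then have "z + h z *\<^sub>R e \<in> prism" using h_nonneg by simp
      then show "?\<phi> x \<in> \<pi> ` prism" using \<pi>_roof z by (metis imageI)
    qed
    ultimately show "P \<subseteq> \<pi> ` prism"
      unfolding P_def using convex_linear_image[OF lin_\<pi> convex_prism] by (intro hull_minimal) auto
  qed
  have polytope_P: "polytope P"
  proof -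
    obtain W where "finite W" "prism = convex hull W"
      using polytope_prism[OF S_polytope] by (auto simp: polytope_def)
    then have "P = convex hull (\<pi> ` W)" "finite (\<pi> ` W)"
      using img_\<pi> convex_hull_linear_image[OF lin_\<pi>] by auto
    then show ?thesis unfolding polytope_def by blast
  qed
  have P_vertE: "(v extreme_point_of P') \<or> (\<exists>u. u extreme_point_of P' \<and> v = ?\<phi> u)"
    if v: "v extreme_point_of P" for v
  proof -
    have "v \<in> P' \<union> ?\<phi> ` P'"
      using v extreme_point_of_convex_hull unfolding P_def by blast
    then show ?thesis
    proof
      assume "v \<in> P'"
      then show ?thesis using v P'P unfolding extreme_point_of_def by blast
    next
      assume "v \<in> ?\<phi> ` P'"
      then obtain u where u: "u \<in> P'" "v = ?\<phi> u" by blast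
      \<comment> \<open>The reflection is affine and injective, so a segment of \<open>P'\<close>
        around \<open>u\<close> would reflect to a segment of \<open>P\<close> around
        \<open>v\<close>.\<close>
      have "u extreme_point_of P'"
        unfolding extreme_point_of_def
      proof (intro conjI ballI notI)
        fix x y assume xy: "x \<in> P'" "y \<in> P'" "u \<in> open_segment x y"
        then obtain t where t: "x \<noteq> y" "0 < t" "t < 1" "u = (1 - t) *\<^sub>R x + t *\<^sub>R y"
          by (auto simp: in_segment)
        have "?\<phi> x \<noteq> ?\<phi> y" using t reflection_reflection[OF a] by metis
        moreover have "v = (1 - t) *\<^sub>R ?\<phi> x + t *\<^sub>R ?\<phi> y"
          using u t by (simp add: reflection_convex_combination)
        ultimately have "v \<in> open_segment (?\<phi> x) (?\<phi> y)" using t by (auto simp: in_segment)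
        then show False using v xy P'P unfolding extreme_point_of_def by blast
      qed (rule u)
      then show ?thesis using u by blast
    qed
  qed
  have P01: "zero_one_polytope P"
    unfolding zero_one_polytope_def
  proof (intro conjI allI impI)
    fix v i assume "v extreme_point_of P"
    then show "v $ i \<in> {0, 1}"
      using P_vertE[of v] P'_vert cube_symmetry_zero_one[OF sym] by blast
  qed (rule polytope_P)
  have prism_vert: "base w extreme_point_of S \<and> base w \<in> S \<and>
      (m w = 0 \<and> \<pi> w = \<pi>' (base w) \<or> m w = h (base w) \<and> \<pi> w = ?\<phi> (\<pi>' (base w)))"
    if w: "w extreme_point_of prism" for w
  proof -
    have "base w extreme_point_of S" using extreme_point_of_prismD[OF w] by blast
    moreover from this have "base w \<in> S" by (simp add: extreme_point_of_def)
    ultimately show ?thesis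
      using extreme_point_of_prismD(2)[OF w] by (auto simp: \<pi>_def \<phi>_eq h_def g_def)
  qed
  have h01: "h z \<in> {0, 1}" if "z extreme_point_of S" for z
  proof -
    have "\<pi>' z extreme_point_of P'" using that by (rule vert)
    moreover from this have "a \<bullet> \<pi>' z \<le> \<beta>" using H by (auto simp: extreme_point_of_def)
    ultimately show ?thesis
      unfolding h_def g_def by (intro cube_symmetry_slack[OF sym] P'_vert)
  qed
  have prism_eq: "prism = {x. x - Poly_Mapping.lookup x q *\<^sub>R Poly_Mapping.single q 1 \<in> S \<and>
      0 \<le> Poly_Mapping.lookup x q \<and>
      Poly_Mapping.lookup x q \<le> \<beta> - g (x - Poly_Mapping.lookup x q *\<^sub>R Poly_Mapping.single q 1)}"
    unfolding prism_def base_def by (simp only: m_def e_def h_def)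
  have prism_poly: "polyhedron_in (Suc q) prism"
    unfolding prism_eq by (rule polyhedron_in_prism[OF S_poly g])
  have prism01: "zero_one_polytope_in (Suc q) prism"
    unfolding zero_one_polytope_in_def
  proof (intro conjI allI impI)
    show "prism \<subseteq> coord_space (Suc q)" using prism_poly by (auto simp: polyhedron_in_def)
    show "polytope prism" using S_polytope by (rule polytope_prism)
    fix w i assume w: "w extreme_point_of prism" and i: "i < Suc q"
    show "Poly_Mapping.lookup w i \<in> {0, 1}"
    proof (cases "i = q")
      case True
      then show ?thesis using prism_vert[OF w] h01[of "base w"] by (auto simp: m_def)
    next
      case False
      then have "Poly_Mapping.lookup w i = Poly_Mapping.lookup (base w) i"
        unfolding base_def by (simp add: e_def lookup_minus lookup_single when_def)
      then show ?thesis using S_vert[of "base w" i] prism_vert[OF w] i False by simp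
    qed
  qed
  have vert_img: "\<pi> w extreme_point_of P" if w: "w extreme_point_of prism" for w
  proof (rule zero_one_point_extreme[OF P01])
    show "\<pi> w \<in> P" using w img_\<pi> by (auto simp: extreme_point_of_def)
    show "\<pi> w $ i \<in> {0, 1}" for i
      using prism_vert[OF w] vert[of "base w"] P'_vert cube_symmetry_zero_one[OF sym] by metis
  qed
  text \<open>A vertex common to \<open>P'\<close> and its mirror image lies on the mirror, where the fibre of the
    prism is a single point.\<close>
  have meet: "u1 = u2 \<and> a \<bullet> u2 = \<beta>" if "u1 \<in> P'" "u2 \<in> P'" "u1 = ?\<phi> u2" for u1 u2
  proof -
    have "a \<bullet> u1 \<le> \<beta>" "a \<bullet> u2 \<le> \<beta>" using that H by auto
    moreover have "a \<bullet> u1 = 2 * \<beta> - a \<bullet> u2" using that inner_reflection[OF a] by simp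
    ultimately have "a \<bullet> u2 = \<beta>" by simp
    then show ?thesis using that by (simp add: \<phi>_eq)
  qed
  \<comment> \<open>If both vertices are on the bottom, or both on the roof, injectivity of the
    reflection gives equal images under \<open>\<pi>'\<close>. At different levels,
    \<open>meet\<close> puts the common image on the mirror, where the roof height is 0. Uniqueness
    in the given extension then identifies the bases, which also makes two roof heights
    agree.\<close>
  have unique: "w1 = w2"
    if w1: "w1 extreme_point_of prism" and w2: "w2 extreme_point_of prism" and eq: "\<pi> w1 = \<pi> w2"
    for w1 w2
  proof -
    note v1 = prism_vert[OF w1] and v2 = prism_vert[OF w2]
    have in_P': "\<pi>' (base w1) \<in> P'" "\<pi>' (base w2) \<in> P'" using v1 v2 img by auto
    have "\<pi>' (base w1) = \<pi>' (base w2) \<and> m w1 = m w2"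
      if base_eq: "\<pi>' (base w1) = \<pi>' (base w2) \<Longrightarrow> base w1 = base w2"
    proof -
      from v1 v2 consider "m w1 = 0" "m w2 = 0" "\<pi> w1 = \<pi>' (base w1)" "\<pi> w2 = \<pi>' (base w2)"
        | "m w1 = 0" "m w2 = h (base w2)" "\<pi> w1 = \<pi>' (base w1)" "\<pi> w2 = ?\<phi> (\<pi>' (base w2))"
        | "m w1 = h (base w1)" "m w2 = 0" "\<pi> w1 = ?\<phi> (\<pi>' (base w1))" "\<pi> w2 = \<pi>' (base w2)"
        | "m w1 = h (base w1)" "m w2 = h (base w2)" "\<pi> w1 = ?\<phi> (\<pi>' (base w1))"
          "\<pi> w2 = ?\<phi> (\<pi>' (base w2))" by blast
      then show ?thesis
      proof cases
        case 1
        then show ?thesis using eq by simp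
      next
        case 2
        then show ?thesis using meet[OF in_P'] eq by (simp add: h_def g_def)
      next
        case 3
        then show ?thesis using meet[OF in_P'(2,1)] eq by (simp add: h_def g_def)
      next
        case 4
        then have "\<pi>' (base w1) = \<pi>' (base w2)" using eq reflection_reflection[OF a] by metis
        then show ?thesis using 4 base_eq by simp
      qed
    qed
    moreover have base_eq: "base w1 = base w2" if "\<pi>' (base w1) = \<pi>' (base w2)"
      using ex1[OF vert, of "base w2"] v1 v2 that by blast
    ultimately have "base w1 = base w2" "m w1 = m w2" by blast+
    then show ?thesis using decompose[of w1] decompose[of w2] by simp
  qed
  have exists: "\<exists>w. w extreme_point_of prism \<and> \<pi> w = v" if v: "v extreme_point_of P" for v
    using P_vertE[OF v]
  proof (elim disjE exE conjE)
    assume "v extreme_point_of P'"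
    then obtain w where w: "w extreme_point_of S" "\<pi>' w = v" using ex1 by blast
    moreover from this have "w \<in> S" by (simp add: extreme_point_of_def)
    ultimately show ?thesis using extreme_point_of_prism_bottom \<pi>_S by blast
  next
    fix u assume "u extreme_point_of P'" and v: "v = ?\<phi> u"
    then obtain w where w: "w extreme_point_of S" "\<pi>' w = u" using ex1 by blast
    moreover from this have "w \<in> S" by (simp add: extreme_point_of_def)
    ultimately show ?thesis using extreme_point_of_prism_roof \<pi>_roof v by blast
  qed
  show thesis
  proof (rule that)
    show "nice_zero_one_extension (Suc q) prism \<pi> (convex hull (P' \<union> ?\<phi> ` P'))"
      unfolding P_def[symmetric] nice_zero_one_extension_def is_extension_def
      using P01 prism_poly lin_\<pi> img_\<pi> prism01 vert_img exists unique by blast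
    show "num_facets prism \<le> num_facets S + 2"
      using S_polytope by (rule num_facets_prism)
  qed
qed

theorem theorem2p9:
  fixes P' :: "(real^'p) set" and a :: "real^'p" and \<beta> :: real
  assumes "zero_one_polytope P'"
    and "induces_cube_symmetry a \<beta>"
    and "P' \<subseteq> {x. a \<bullet> x \<le> \<beta>}"
  shows "xc_star (convex hull (P' \<union> reflection a \<beta> ` P')) \<le> xc_star P' + 2"
proof -
  let ?sizes = "\<lambda>P :: (real^'p) set. {enat (num_facets Q) | q Q \<pi>. nice_zero_one_extension q Q \<pi> P}"
  show ?thesis
  proof (cases "?sizes P' = {}")
    \<comment> \<open>Without any nice extension of \<open>P'\<close> the infimum in
      \<open>enat\<close> is \<infinity> and the bound is trivial.\<close>
    case True
    then have "xc_star P' = \<infinity>" unfolding xc_star_def by (simp add: Inf_enat_def)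
    then show ?thesis by simp
  next
    case False
    \<comment> \<open>A nonempty infimum in \<open>enat\<close> is attained, which supplies a
      minimal extension.\<close>
    then have "xc_star P' \<in> ?sizes P'"
      unfolding xc_star_def Inf_enat_def by (simp only: if_False) (rule LeastI_ex, blast)
    then obtain q S \<pi>' where S: "xc_star P' = enat (num_facets S)" "nice_zero_one_extension q S \<pi>' P'"
      by blast
    obtain Q \<pi> where Q:
      "nice_zero_one_extension (Suc q) Q \<pi> (convex hull (P' \<union> reflection a \<beta> ` P'))"
      "num_facets Q \<le> num_facets S + 2"
      using nice_zero_one_extension_reflection[OF assms(2,3) S(2)] .
    have "xc_star (convex hull (P' \<union> reflection a \<beta> ` P')) \<le> enat (num_facets Q)"
      unfolding xc_star_def using Q(1) by (intro Inf_lower) blast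
    also have "\<dots> \<le> enat (num_facets S) + 2"
      using Q(2) by (simp add: numeral_eq_enat)
    finally show ?thesis using S(1) by simp
  qed
qed

end
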